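(* Let $A\in\mathbb{R}^{n\times d}$ have SVD $A=U\Sigma V^T$ with singular values $\sigma_1\ge\dots\ge\sigma_d>0$, let $1\le k<d$ and $\Delta>0$, and assume $\sigma_k^2-\sigma_{k+1}^2\ge\Delta\sigma_1^2$. Let $\tilde A\in\mathbb{R}^{n\times\ell}$ satisfy $\|AA^T-\tilde A\tilde A^T\|\le\mu\sigma_1^2$, with SVD $\tilde A=\tilde U\tilde\Sigma\tilde V^T$. If $\mu\le\min(\Delta^3k^2,\,1/(20k))$, then $$\|U_k\Sigma_k^2U_k^T-\tilde U_k\Sigma_k^2\tilde U_k^T\|\le 8\sigma_1^2(\mu k)^{1/3}.$$
   Context: $\|\cdot\|$ is the operator (spectral) norm. Singular values are ordered non-increasingly. $U_k$ and $\tilde U_k$ denote the $n\times k$ matrices whose columns are the first $k$ columns of $U$ and $\tilde U$ (top $k$ left singular vectors, in order), and $\Sigma_k=\mathrm{diag}(\sigma_1,\dots,\sigma_k)$ contains the top $k$ singular values of $A$ (the same $\Sigma_k$ appears in both terms). *)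

theory Defs
  imports Complex_Main "Jordan_Normal_Form.Matrix"
begin

definition vec_norm2 :: "real vec \<Rightarrow> real" where
  "vec_norm2 v = sqrt (v \<bullet> v)"

(* The unit ball is used instead of the unit sphere so that the supremum is over a
   nonempty set even when there are no columns. *)
definition op_norm :: "real mat \<Rightarrow> real" where
  "op_norm M = (SUP v \<in> {v \<in> carrier_vec (dim_col M). vec_norm2 v \<le> 1}. vec_norm2 (M *\<^sub>v v))"

(* The library's orthogonal_mat only asks for nonzero pairwise orthogonal columns;
   here the columns are orthonormal. *)
definition orthonormal_square_mat :: "nat \<Rightarrow> real mat \<Rightarrow> bool" where
  "orthonormal_square_mat n U \<longleftrightarrow>
     U \<in> carrier_mat n n \<and> U\<^sup>T * U = 1\<^sub>m n \<and> U * U\<^sup>T = 1\<^sub>m n"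

(* Singular values are indexed from 1, matrix entries from 0. *)
definition rect_diag :: "nat \<Rightarrow> nat \<Rightarrow> (nat \<Rightarrow> real) \<Rightarrow> real mat" where
  "rect_diag n d \<sigma> = Matrix.mat n d (\<lambda>(i, j). if i = j then \<sigma> (Suc i) else 0)"

(* Full singular value decomposition A = U S V^T of an n x d matrix, S = rect_diag n d \<sigma>.
   Indices beyond min n d carry the singular value 0; in particular 0 < \<sigma> d
   forces d \<le> n (for d \<ge> 1). The value \<sigma> 0 is irrelevant. *)
definition is_svd ::
  "nat \<Rightarrow> nat \<Rightarrow> real mat \<Rightarrow> real mat \<Rightarrow> (nat \<Rightarrow> real) \<Rightarrow> real mat \<Rightarrow> bool" where
  "is_svd n d A U \<sigma> V \<longleftrightarrow>
     A \<in> carrier_mat n d \<and>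
     orthonormal_square_mat n U \<and> orthonormal_square_mat d V \<and>
     (\<forall>i \<ge> 1. 0 \<le> \<sigma> i) \<and>
     (\<forall>i j. 1 \<le> i \<longrightarrow> i \<le> j \<longrightarrow> \<sigma> j \<le> \<sigma> i) \<and>
     (\<forall>i > min n d. \<sigma> i = 0) \<and>
     A = U * rect_diag n d \<sigma> * V\<^sup>T"

definition first_cols :: "nat \<Rightarrow> 'a mat \<Rightarrow> 'a mat" where
  "first_cols k U = mat_of_cols (dim_row U) (take k (cols U))"

definition top_singular_mat :: "nat \<Rightarrow> (nat \<Rightarrow> real) \<Rightarrow> real mat" where
  "top_singular_mat k \<sigma> = mat_diag k (\<lambda>i. \<sigma> (Suc i))"

end

theory Submission
  imports Defs "HOL-Analysis.L2_Norm" "Jordan_Normal_Form.Determinant"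
begin

text \<open>
  Let \<open>P\<close> and \<open>P'\<close> be the orthogonal projections onto the spans of the top \<open>k\<close> left singular vectors
  of \<open>A\<close> and \<open>A'\<close>, let \<open>B = A A\<^sup>T\<close>, \<open>B' = A' A'\<^sup>T\<close>, and let \<open>D\<close>, \<open>D'\<close> contain the top \<open>k\<close>
  eigenvalues of \<open>B\<close>, \<open>B'\<close>. The difference to be estimated equals
  \<open>(P - P') B + P' (B - B') + U'\<^sub>k (D' - D) U'\<^sub>k\<^sup>T\<close>. The last two summands are at most \<open>\<mu> \<sigma>\<^sub>1\<^sup>2\<close> in norm,
  the third one by Weyl's inequality. Since \<open>P - P' = P (1 - P') - (1 - P) P'\<close>, the Davis-Kahan
  argument bounds \<open>P - P'\<close> by \<open>2 \<mu> / (\<Delta> - \<mu>)\<close>. For \<open>t = (\<mu> k)\<^bsup>1/3\<^esup>\<close> the hypothesis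
  \<open>\<mu> \<le> \<Delta>\<^sup>3 k\<^sup>2\<close> says \<open>\<mu> \<le> \<Delta> t\<^sup>2\<close>, and \<open>t\<^sup>3 \<le> 1/20\<close>, so the total is \<open>O(t\<^sup>2) \<sigma>\<^sub>1\<^sup>2\<close>, well
  below \<open>8 t \<sigma>\<^sub>1\<^sup>2\<close>.
\<close>

section \<open>The Euclidean norm and the operator norm\<close>

lemma vec_norm2_eq_L2_set: "vec_norm2 v = L2_set (($) v) {0..<dim_vec v}"
  by (simp add: vec_norm2_def L2_set_def scalar_prod_def power2_eq_square)

lemma vec_norm2_nonneg [simp]: "0 \<le> vec_norm2 v"
  by (simp add: vec_norm2_eq_L2_set)

lemma vec_norm2_sq: "(vec_norm2 v)\<^sup>2 = v \<bullet> v"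
  by (simp add: vec_norm2_def scalar_prod_def sum_nonneg)

lemma vec_norm2_zero [simp]: "vec_norm2 (0\<^sub>v n) = 0"
  by (simp add: vec_norm2_def)

lemma vec_norm2_eq_0D:
  assumes "vec_norm2 v = 0" "v \<in> carrier_vec n"
  shows "v = 0\<^sub>v n"
  using assms by (auto simp: vec_norm2_eq_L2_set L2_set_eq_0_iff)

lemma vec_norm2_triangle:
  assumes "u \<in> carrier_vec n" "v \<in> carrier_vec n"
  shows "vec_norm2 (u + v) \<le> vec_norm2 u + vec_norm2 v"
proof -
  have "vec_norm2 (u + v) = L2_set (\<lambda>i. u $ i + v $ i) {0..<n}"
    using assms by (auto simp: vec_norm2_eq_L2_set intro!: L2_set_cong)
  then show ?thesis
    using assms L2_set_triangle_ineq[of "($) u" "($) v" "{0..<n}"]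
    by (simp add: vec_norm2_eq_L2_set)
qed

lemma vec_norm2_smult: "vec_norm2 (c \<cdot>\<^sub>v v) = \<bar>c\<bar> * vec_norm2 v"
proof -
  have "(c \<cdot>\<^sub>v v) \<bullet> (c \<cdot>\<^sub>v v) = c\<^sup>2 * (v \<bullet> v)"
    by (simp add: scalar_prod_def power2_eq_square sum_distrib_left algebra_simps)
  then show ?thesis
    by (simp add: vec_norm2_def real_sqrt_mult)
qed

lemma abs_scalar_prod_le:
  assumes "dim_vec u = dim_vec v"
  shows "\<bar>u \<bullet> v\<bar> \<le> vec_norm2 u * vec_norm2 v"
proof -
  have "\<bar>u \<bullet> v\<bar> \<le> (\<Sum>i\<in>{0..<dim_vec v}. \<bar>u $ i\<bar> * \<bar>v $ i\<bar>)"
    unfolding scalar_prod_def by (rule order.trans[OF sum_abs]) (simp add: abs_mult)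
  also have "\<dots> \<le> vec_norm2 u * vec_norm2 v"
    using L2_set_mult_ineq[of "($) u" "($) v" "{0..<dim_vec v}"] assms
    by (simp add: vec_norm2_eq_L2_set)
  finally show ?thesis .
qed

lemma op_norm_le:
  assumes "\<And>v. v \<in> carrier_vec (dim_col M) \<Longrightarrow> vec_norm2 v \<le> 1 \<Longrightarrow> vec_norm2 (M *\<^sub>v v) \<le> c"
  shows "op_norm M \<le> c"
  unfolding op_norm_def
proof (rule cSUP_least)
  show "{v \<in> carrier_vec (dim_col M). vec_norm2 v \<le> 1} \<noteq> {}"
    by (auto intro!: exI[of _ "0\<^sub>v (dim_col M)"])
qed (use assms in auto)

text \<open>A supremum of reals is meaningful only over a set bounded above, so every later appeal
  to \<open>cSUP_upper\<close> rests on this. The crude bound by the sum of the row norms, from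
  Cauchy-Schwarz in each row, suffices.\<close>

lemma bdd_above_op_norm:
  "bdd_above ((\<lambda>v. vec_norm2 (M *\<^sub>v v)) ` {v \<in> carrier_vec (dim_col M). vec_norm2 v \<le> 1})"
proof (rule bdd_aboveI2)
  fix v assume v: "v \<in> {v \<in> carrier_vec (dim_col M). vec_norm2 v \<le> 1}"
  have "vec_norm2 (M *\<^sub>v v) \<le> (\<Sum>i\<in>{0..<dim_row M}. \<bar>(M *\<^sub>v v) $ i\<bar>)"
    unfolding vec_norm2_eq_L2_set using L2_set_le_sum_abs[of "($) (M *\<^sub>v v)"] by (simp del: index_mult_mat_vec)
  also have "\<dots> \<le> (\<Sum>i\<in>{0..<dim_row M}. vec_norm2 (row M i))"
  proof (rule sum_mono)
    fix i assume i: "i \<in> {0..<dim_row M}"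
    have "\<bar>row M i \<bullet> v\<bar> \<le> vec_norm2 (row M i) * vec_norm2 v"
      by (rule abs_scalar_prod_le) (use v in auto)
    also have "\<dots> \<le> vec_norm2 (row M i) * 1"
      by (rule mult_left_mono) (use v in auto)
    finally show "\<bar>(M *\<^sub>v v) $ i\<bar> \<le> vec_norm2 (row M i)"
      using i by simp
  qed
  finally show "vec_norm2 (M *\<^sub>v v) \<le> (\<Sum>i\<in>{0..<dim_row M}. vec_norm2 (row M i))" .
qed

lemma op_norm_nonneg [simp]: "0 \<le> op_norm M"
proof -
  have "vec_norm2 (M *\<^sub>v 0\<^sub>v (dim_col M)) \<le> op_norm M"
    unfolding op_norm_def by (rule cSUP_upper[OF _ bdd_above_op_norm]) auto
  then show ?thesis
    using vec_norm2_nonneg order.trans by blast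
qed

text \<open>Rescaling a nonzero \<open>v\<close> to length 1 puts it into the unit ball of the
  supremum. This is the form in which the operator norm is applied afterwards.\<close>

lemma vec_norm2_mult_le:
  assumes M: "M \<in> carrier_mat m n" and v: "v \<in> carrier_vec n"
  shows "vec_norm2 (M *\<^sub>v v) \<le> op_norm M * vec_norm2 v"
proof (cases "vec_norm2 v = 0")
  case True
  then have "v = 0\<^sub>v n"
    using v by (rule vec_norm2_eq_0D)
  moreover have "M *\<^sub>v 0\<^sub>v n = 0\<^sub>v m"
    using M by auto
  ultimately show ?thesis
    by simp
next
  case False
  define c where "c = 1 / vec_norm2 v"
  have c: "c > 0" and c_norm: "c * vec_norm2 v = 1"
    using False by (simp_all add: c_def less_le)
  have "vec_norm2 (M *\<^sub>v (c \<cdot>\<^sub>v v)) \<le> op_norm M"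
    unfolding op_norm_def
    by (rule cSUP_upper[OF _ bdd_above_op_norm]) (use M v c c_norm in \<open>auto simp: vec_norm2_smult\<close>)
  moreover have "M *\<^sub>v (c \<cdot>\<^sub>v v) = c \<cdot>\<^sub>v (M *\<^sub>v v)"
    using M v by (rule mult_mat_vec)
  ultimately have "c * vec_norm2 (M *\<^sub>v v) \<le> op_norm M"
    using c by (simp add: vec_norm2_smult)
  then show ?thesis
    using False by (simp add: c_def field_simps less_le)
qed

lemma op_norm_add_le:
  assumes "A \<in> carrier_mat m n" "B \<in> carrier_mat m n"
  shows "op_norm (A + B) \<le> op_norm A + op_norm B"
proof (rule op_norm_le)
  fix v assume v: "v \<in> carrier_vec (dim_col (A + B))" "vec_norm2 v \<le> 1"
  then have vn: "v \<in> carrier_vec n"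
    using assms by simp
  have "vec_norm2 ((A + B) *\<^sub>v v) \<le> vec_norm2 (A *\<^sub>v v) + vec_norm2 (B *\<^sub>v v)"
    unfolding add_mult_distrib_mat_vec[OF assms vn]
    by (rule vec_norm2_triangle[of _ m]) (use assms vn in auto)
  also have "\<dots> \<le> op_norm A * vec_norm2 v + op_norm B * vec_norm2 v"
    using vec_norm2_mult_le[OF _ vn] assms by (intro add_mono) auto
  also have "\<dots> \<le> op_norm A + op_norm B"
    using v(2) by (intro add_mono mult_left_le) auto
  finally show "vec_norm2 ((A + B) *\<^sub>v v) \<le> op_norm A + op_norm B" .
qed

lemma op_norm_uminus_le:
  assumes A: "A \<in> carrier_mat m n"
  shows "op_norm (- A) \<le> op_norm A"
proof (rule op_norm_le)
  fix v assume v: "v \<in> carrier_vec (dim_col (- A))" "vec_norm2 v \<le> 1"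
  then have vn: "v \<in> carrier_vec n"
    using A by simp
  have "(- A) *\<^sub>v v = (- 1) \<cdot>\<^sub>v (A *\<^sub>v v)"
    using A vn by (intro eq_vecI) auto
  then have "vec_norm2 ((- A) *\<^sub>v v) \<le> op_norm A * vec_norm2 v"
    using vec_norm2_mult_le[OF A vn] by (simp add: vec_norm2_smult)
  also have "\<dots> \<le> op_norm A"
    using v(2) by (intro mult_left_le) auto
  finally show "vec_norm2 ((- A) *\<^sub>v v) \<le> op_norm A" .
qed

lemma op_norm_diff_le:
  assumes "A \<in> carrier_mat m n" "B \<in> carrier_mat m n"
  shows "op_norm (A - B) \<le> op_norm A + op_norm B"
  using op_norm_add_le[of A m n "- B"] op_norm_uminus_le[OF assms(2)] assms
  by (simp add: minus_add_uminus_mat[OF assms])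

lemma op_norm_minus_commute_le:
  assumes "A \<in> carrier_mat m n" "B \<in> carrier_mat m n"
  shows "op_norm (A - B) \<le> op_norm (B - A)"
proof -
  have "A - B = - (B - A)"
    using assms by (intro eq_matI) auto
  then show ?thesis
    using op_norm_uminus_le[of "B - A" m n] assms by (simp add: minus_carrier_mat)
qed

lemma op_norm_mult_le:
  assumes A: "A \<in> carrier_mat l m" and B: "B \<in> carrier_mat m n"
  shows "op_norm (A * B) \<le> op_norm A * op_norm B"
proof (rule op_norm_le)
  fix v assume v: "v \<in> carrier_vec (dim_col (A * B))" "vec_norm2 v \<le> 1"
  then have vn: "v \<in> carrier_vec n"
    using B by simp
  have "vec_norm2 ((A * B) *\<^sub>v v) \<le> op_norm A * vec_norm2 (B *\<^sub>v v)"
    using vec_norm2_mult_le[OF A, of "B *\<^sub>v v"] A B vn by simp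
  also have "\<dots> \<le> op_norm A * (op_norm B * vec_norm2 v)"
    using vec_norm2_mult_le[OF B vn] by (intro mult_left_mono) auto
  also have "\<dots> \<le> op_norm A * op_norm B"
    using v(2) by (intro mult_left_mono mult_left_le) auto
  finally show "vec_norm2 ((A * B) *\<^sub>v v) \<le> op_norm A * op_norm B" .
qed

lemma op_norm_mult3_le:
  assumes "A \<in> carrier_mat n n" "B \<in> carrier_mat n n" "C \<in> carrier_mat n n"
    and "op_norm A \<le> a" "op_norm B \<le> b" "op_norm C \<le> c"
  shows "op_norm (A * B * C) \<le> a * b * c"
proof -
  have a: "0 \<le> a" and b: "0 \<le> b"
    using assms(4,5) op_norm_nonneg order.trans by blast+
  have "op_norm (A * B * C) \<le> op_norm A * op_norm B * op_norm C"
    by (rule order.trans[OF op_norm_mult_le[of _ n n _ n]])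
      (use assms in \<open>auto intro!: mult_right_mono op_norm_mult_le[of _ n n _ n]\<close>)
  also have "\<dots> \<le> a * b * c"
    using assms a b by (intro mult_mono) auto
  finally show ?thesis .
qed

text \<open>With \<open>w\<close> the image of \<open>v\<close> under the transpose, the square of
  the norm of \<open>w\<close> is the inner product of \<open>v\<close> with
  \<open>A *\<^sub>v w\<close>. Cauchy-Schwarz bounds it by \<open>op_norm A * vec_norm2 w\<close>,
  and one factor \<open>vec_norm2 w\<close> cancels.\<close>

lemma op_norm_transpose_le:
  assumes A: "A \<in> carrier_mat m n"
  shows "op_norm (A\<^sup>T) \<le> op_norm A"
proof (rule op_norm_le)
  fix v assume v: "v \<in> carrier_vec (dim_col (A\<^sup>T))" "vec_norm2 v \<le> 1"
  then have vm: "v \<in> carrier_vec m"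
    using A by simp
  define w where "w = A\<^sup>T *\<^sub>v v"
  have w: "w \<in> carrier_vec n"
    using A vm by (simp add: w_def)
  have "(vec_norm2 w)\<^sup>2 = v \<bullet> (A *\<^sub>v w)"
    unfolding vec_norm2_sq using transpose_vec_mult_scalar[OF A w vm] by (simp add: w_def)
  also have "\<dots> \<le> vec_norm2 v * vec_norm2 (A *\<^sub>v w)"
    using abs_scalar_prod_le[of v "A *\<^sub>v w"] A vm by simp
  also have "\<dots> \<le> 1 * (op_norm A * vec_norm2 w)"
    using v(2) vec_norm2_mult_le[OF A w] by (intro mult_mono) auto
  finally have "vec_norm2 w * vec_norm2 w \<le> op_norm A * vec_norm2 w"
    by (simp add: power2_eq_square)
  then show "vec_norm2 (A\<^sup>T *\<^sub>v v) \<le> op_norm A"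
    unfolding w_def[symmetric]
    by (cases "vec_norm2 w = 0") (auto simp: less_le)
qed

lemma mat_diff_add_cancel:
  fixes A B :: "'a :: group_add mat"
  assumes "A \<in> carrier_mat m n" "B \<in> carrier_mat m n"
  shows "A - B + B = A"
  using assms by (intro eq_matI) auto

section \<open>Functions of a symmetric matrix\<close>

text \<open>For orthonormal \<open>U\<close> this is functional calculus in a fixed eigenbasis:
  products and differences act on \<open>f\<close> pointwise, and functions of the form
  \<open>of_bool\<close> give the orthogonal projections onto spans of columns of \<open>U\<close>.
  Projections, truncations, partial inverses and Gram matrices thus all become values of
  \<open>spec\<close>.\<close>

definition spec :: "real mat \<Rightarrow> (nat \<Rightarrow> real) \<Rightarrow> real mat" where
  "spec U f = U * mat_diag (dim_col U) f * U\<^sup>T"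

lemma orthonormal_vec_norm2:
  assumes "orthonormal_square_mat n U" and v: "v \<in> carrier_vec n"
  shows "vec_norm2 (U *\<^sub>v v) = vec_norm2 v" "vec_norm2 (U\<^sup>T *\<^sub>v v) = vec_norm2 v"
proof -
  have U: "U \<in> carrier_mat n n" and o: "U\<^sup>T * U = 1\<^sub>m n" "U * U\<^sup>T = 1\<^sub>m n"
    using assms by (auto simp: orthonormal_square_mat_def)
  have iso: "vec_norm2 (M *\<^sub>v v) = vec_norm2 v"
    if M: "M \<in> carrier_mat n n" and "M\<^sup>T * M = 1\<^sub>m n" for M
  proof -
    have "(M *\<^sub>v v) \<bullet> (M *\<^sub>v v) = (M\<^sup>T *\<^sub>v (M *\<^sub>v v)) \<bullet> v"
      using transpose_vec_mult_scalar[OF M v, of "M *\<^sub>v v"] M v by simp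
    also have "M\<^sup>T *\<^sub>v (M *\<^sub>v v) = (M\<^sup>T * M) *\<^sub>v v"
      using M v by simp
    finally show ?thesis
      using that v by (simp add: vec_norm2_def)
  qed
  show "vec_norm2 (U *\<^sub>v v) = vec_norm2 v" "vec_norm2 (U\<^sup>T *\<^sub>v v) = vec_norm2 v"
    using iso[of U] iso[of "U\<^sup>T"] U o by auto
qed

lemma mat_diag_mult_vec:
  assumes "v \<in> carrier_vec n"
  shows "mat_diag n f *\<^sub>v v = vec n (\<lambda>i. f i * v $ i)"
proof (rule eq_vecI)
  fix i assume i: "i < dim_vec (vec n (\<lambda>i. f i * v $ i))"
  have "(mat_diag n f *\<^sub>v v) $ i = (\<Sum>j\<in>{0..<n}. (if i = j then f j else 0) * v $ j)"
    using i assms by (simp add: mat_diag_def scalar_prod_def)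
  also have "\<dots> = (\<Sum>j\<in>{0..<n}. if j = i then f i * v $ i else 0)"
    by (rule sum.cong) auto
  finally show "(mat_diag n f *\<^sub>v v) $ i = vec n (\<lambda>i. f i * v $ i) $ i"
    using i by simp
qed (simp add: mat_diag_def)

lemma op_norm_mat_diag_le:
  assumes "0 \<le> c" and f: "\<And>i. i < n \<Longrightarrow> \<bar>f i\<bar> \<le> c"
  shows "op_norm (mat_diag n f) \<le> c"
proof (rule op_norm_le)
  fix v assume "v \<in> carrier_vec (dim_col (mat_diag n f))" and 1: "vec_norm2 v \<le> 1"
  then have v: "v \<in> carrier_vec n"
    by (simp add: mat_diag_def)
  have "vec_norm2 (mat_diag n f *\<^sub>v v) = L2_set (\<lambda>i. \<bar>f i * v $ i\<bar>) {0..<n}"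
    using v by (simp add: mat_diag_mult_vec vec_norm2_eq_L2_set L2_set_def)
  also have "\<dots> \<le> L2_set (\<lambda>i. c * \<bar>v $ i\<bar>) {0..<n}"
    using f by (intro L2_set_mono) (auto simp: abs_mult intro!: mult_right_mono)
  also have "\<dots> = c * vec_norm2 v"
    using v \<open>0 \<le> c\<close> unfolding vec_norm2_eq_L2_set
    by (subst L2_set_right_distrib[symmetric]) (auto simp: L2_set_def)
  also have "\<dots> \<le> c"
    using 1 \<open>0 \<le> c\<close> by (simp add: mult_left_le)
  finally show "vec_norm2 (mat_diag n f *\<^sub>v v) \<le> c" .
qed

context
  fixes n U
  assumes orth: "orthonormal_square_mat n U"
begin

lemma orth_carrier: "U \<in> carrier_mat n n"
  using orth by (simp add: orthonormal_square_mat_def)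

lemma spec_eq: "spec U f = U * mat_diag n f * U\<^sup>T"
  using orth_carrier by (simp add: spec_def)

lemmas sq_simps = mult_carrier_mat[of _ n n _ n] assoc_mult_mat[of _ n n _ n _ n]

lemma spec_carrier [simp]: "spec U f \<in> carrier_mat n n"
  using orth_carrier by (simp add: spec_eq sq_simps)

lemma spec_mult: "spec U f * spec U g = spec U (\<lambda>i. f i * g i)"
proof -
  note U = orth_carrier
  have "spec U f * spec U g = U * mat_diag n f * (U\<^sup>T * U) * mat_diag n g * U\<^sup>T"
    using U by (simp add: spec_eq sq_simps)
  also have "U\<^sup>T * U = 1\<^sub>m n"
    using orth by (simp add: orthonormal_square_mat_def)
  also have "U * mat_diag n f * 1\<^sub>m n * mat_diag n g * U\<^sup>T
      = U * (mat_diag n f * mat_diag n g) * U\<^sup>T"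
    using U by (simp add: sq_simps left_mult_one_mat[of _ n n] del: mat_diag_diag)
  finally show ?thesis
    by (simp add: spec_eq)
qed

lemma spec_diff: "spec U f - spec U g = spec U (\<lambda>i. f i - g i)"
proof -
  note U = orth_carrier
  have "mat_diag n (\<lambda>i. f i - g i) = mat_diag n f - mat_diag n g"
    by (intro eq_matI) (auto simp: mat_diag_def)
  then show ?thesis
    using U by (simp add: spec_eq sq_simps minus_carrier_mat
        mult_minus_distrib_mat[of _ n n _ n] minus_mult_distrib_mat[of _ n n _ _ n])
qed

lemma spec_cong: "(\<And>i. i < n \<Longrightarrow> f i = g i) \<Longrightarrow> spec U f = spec U g"
  unfolding spec_eq by (rule arg_cong[of _ _ "\<lambda>D. U * D * U\<^sup>T"]) (auto simp: mat_diag_def)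

lemma spec_one: "spec U (\<lambda>_. 1) = 1\<^sub>m n"
  using orth orth_carrier by (simp add: spec_eq orthonormal_square_mat_def)

lemma transpose_spec: "(spec U f)\<^sup>T = spec U f"
proof -
  note U = orth_carrier
  have "(mat_diag n f)\<^sup>T = mat_diag n f"
    by (intro eq_matI) (auto simp: mat_diag_def)
  then show ?thesis
    using U by (simp add: spec_eq transpose_mult[of _ n n _ n] sq_simps)
qed

text \<open>Orthonormal matrices preserve length, so only the diagonal factor contributes.\<close>

lemma op_norm_spec_le:
  assumes "0 \<le> c" "\<And>i. i < n \<Longrightarrow> \<bar>f i\<bar> \<le> c"
  shows "op_norm (spec U f) \<le> c"
proof -
  note U = orth_carrier
  have "op_norm U \<le> 1" "op_norm (U\<^sup>T) \<le> 1"
    using U by (auto intro!: op_norm_le simp: orthonormal_vec_norm2[OF orth])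
  moreover have "op_norm (mat_diag n f) \<le> c"
    using assms by (rule op_norm_mat_diag_le)
  ultimately have "op_norm (U * mat_diag n f * U\<^sup>T) \<le> 1 * c * 1"
    using U by (intro op_norm_mult3_le[of _ n]) auto
  then show ?thesis
    by (simp add: spec_eq)
qed

lemma spec_quadratic_form:
  assumes "x \<in> carrier_vec n"
  shows "x \<bullet> (spec U f *\<^sub>v x) = (\<Sum>i<n. f i * ((U\<^sup>T *\<^sub>v x) $ i)\<^sup>2)"
proof -
  note U = orth_carrier
  define y where "y = U\<^sup>T *\<^sub>v x"
  have y: "y \<in> carrier_vec n"
    using U assms by (simp add: y_def)
  have "x \<bullet> (spec U f *\<^sub>v x) = x \<bullet> (U *\<^sub>v (mat_diag n f *\<^sub>v y))"
    using U assms by (simp add: spec_eq sq_simps y_def assoc_mult_mat_vec[of _ n n _ n])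
  also have "\<dots> = y \<bullet> (mat_diag n f *\<^sub>v y)"
    unfolding y_def by (rule transpose_vec_mult_scalar[OF U, symmetric])
      (use assms y in \<open>auto simp: y_def[symmetric] mat_diag_mult_vec\<close>)
  also have "\<dots> = (\<Sum>i<n. f i * (y $ i)\<^sup>2)"
    using y by (auto simp: scalar_prod_def mat_diag_mult_vec atLeast0LessThan power2_eq_square
        intro!: sum.cong)
  finally show ?thesis
    by (simp add: y_def)
qed

end


section \<open>Gram matrices and truncations as functions of a symmetric matrix\<close>

text \<open>The factor \<open>V\<close> cancels because its columns are orthonormal, which leaves
  the square of the rectangular diagonal factor.\<close>

lemma svd_gram:
  assumes "is_svd n d A U \<sigma> V"
  shows "A * A\<^sup>T = spec U (\<lambda>i. (\<sigma> (Suc i))\<^sup>2)"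
proof -
  define R where "R = rect_diag n d \<sigma>"
  have U: "U \<in> carrier_mat n n" and V: "V \<in> carrier_mat d d" and oV: "V\<^sup>T * V = 1\<^sub>m d"
    and R: "R \<in> carrier_mat n d" and A: "A = U * R * V\<^sup>T" and zero: "\<And>i. i > min n d \<Longrightarrow> \<sigma> i = 0"
    and orth: "orthonormal_square_mat n U"
    using assms by (auto simp: is_svd_def orthonormal_square_mat_def R_def rect_diag_def)
  have UR: "U * R \<in> carrier_mat n d"
    using U R by simp
  have "A * A\<^sup>T = U * R * (V\<^sup>T * V) * (U * R)\<^sup>T"
    using UR V unfolding A
    by (simp add: transpose_mult[of _ n d _ d] mult_carrier_mat[of _ n d _ d]
        mult_carrier_mat[of _ d d _ n] assoc_mult_mat[of _ n d _ d _ n] assoc_mult_mat[of _ d d _ d _ n])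
  also have "\<dots> = U * (R * R\<^sup>T) * U\<^sup>T"
    using UR U R unfolding oV
    by (simp add: transpose_mult[of _ n n _ d] mult_carrier_mat[of _ n d _ n]
        mult_carrier_mat[of _ d n _ n] assoc_mult_mat[of _ n n _ d _ n] assoc_mult_mat[of _ n d _ n _ n]
        assoc_mult_mat[of _ n n _ n _ n])
  also have "R * R\<^sup>T = mat_diag n (\<lambda>i. (\<sigma> (Suc i))\<^sup>2)"
  proof (rule eq_matI)
    fix i j assume "i < dim_row (mat_diag n (\<lambda>i. (\<sigma> (Suc i))\<^sup>2))" "j < dim_col (mat_diag n (\<lambda>i. (\<sigma> (Suc i))\<^sup>2))"
    then have ij: "i < n" "j < n"
      by (auto simp: mat_diag_def)
    have "(R * R\<^sup>T) $$ (i, j) = (\<Sum>m\<in>{0..<d}. (if i = m then \<sigma> (Suc i) else 0) * (if j = m then \<sigma> (Suc j) else 0))"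
      using ij by (simp add: R_def rect_diag_def scalar_prod_def)
    also have "\<dots> = (\<Sum>m\<in>{0..<d}. if m = i then (if i = j then (\<sigma> (Suc i))\<^sup>2 else 0) else 0)"
      by (rule sum.cong) (auto simp: power2_eq_square)
    \<comment> \<open>If \<open>d \<le> i\<close>, no summand has \<open>m = i\<close> and the sum
      is 0; this agrees with the right side because singular values beyond \<open>min n d\<close>
      are 0.\<close>
    also have "\<dots> = (if i = j then (\<sigma> (Suc i))\<^sup>2 else 0)"
      using zero[of "Suc i"] by (cases "i < d") auto
    finally show "(R * R\<^sup>T) $$ (i, j) = mat_diag n (\<lambda>i. (\<sigma> (Suc i))\<^sup>2) $$ (i, j)"
      using ij by (simp add: mat_diag_def)
  qed (use R in \<open>auto simp: mat_diag_def\<close>)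
  finally show ?thesis
    using U by (simp add: spec_eq[OF orth])
qed

text \<open>Dropping the columns from index \<open>k\<close> on amounts to annihilating their
  diagonal entries. Since \<open>U\<close> and \<open>\<sigma>\<close> are independent here, the
  lemma also covers the mixed term with the singular vectors of one matrix and the singular values
  of the other.\<close>

lemma truncated_eq_spec:
  assumes orth: "orthonormal_square_mat n U" and "k \<le> n"
  shows "first_cols k U * (top_singular_mat k \<sigma> ^\<^sub>m 2) * (first_cols k U)\<^sup>T
    = spec U (\<lambda>i. of_bool (i < k) * (\<sigma> (Suc i))\<^sup>2)"
proof -
  define F where "F = first_cols k U"
  have U: "U \<in> carrier_mat n n"
    using orth by (rule orth_carrier)
  have F: "F \<in> carrier_mat n k"
    using U \<open>k \<le> n\<close> by (auto simp: F_def first_cols_def)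
  have F_entry: "F $$ (i, j) = U $$ (i, j)" if "i < n" "j < k" for i j
    using that U \<open>k \<le> n\<close> by (simp add: F_def first_cols_def mat_of_cols_index)
  have sq: "top_singular_mat k \<sigma> ^\<^sub>m 2 = mat_diag k (\<lambda>i. (\<sigma> (Suc i))\<^sup>2)"
    by (simp add: top_singular_mat_def numeral_2_eq_2 power2_eq_square left_mult_one_mat[of _ k k])
  show ?thesis
  proof (rule eq_matI)
    fix i j assume "i < dim_row (spec U (\<lambda>i. of_bool (i < k) * (\<sigma> (Suc i))\<^sup>2))"
      "j < dim_col (spec U (\<lambda>i. of_bool (i < k) * (\<sigma> (Suc i))\<^sup>2))"
    then have ij: "i < n" "j < n"
      using spec_carrier[OF orth, of "\<lambda>i. of_bool (i < k) * (\<sigma> (Suc i))\<^sup>2"] by auto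
    have "(F * mat_diag k (\<lambda>i. (\<sigma> (Suc i))\<^sup>2) * F\<^sup>T) $$ (i, j)
        = (\<Sum>m\<in>{0..<k}. F $$ (i, m) * (\<sigma> (Suc m))\<^sup>2 * F $$ (j, m))"
      using F ij by (simp add: mat_diag_mult_right[OF F] scalar_prod_def)
    also have "\<dots> = (\<Sum>m\<in>{0..<k}. U $$ (i, m) * (of_bool (m < k) * (\<sigma> (Suc m))\<^sup>2) * U $$ (j, m))"
      using ij F_entry by (intro sum.cong) auto
    also have "\<dots> = (\<Sum>m\<in>{0..<n}. U $$ (i, m) * (of_bool (m < k) * (\<sigma> (Suc m))\<^sup>2) * U $$ (j, m))"
      using \<open>k \<le> n\<close> by (intro sum.mono_neutral_left) auto
    also have "\<dots> = spec U (\<lambda>i. of_bool (i < k) * (\<sigma> (Suc i))\<^sup>2) $$ (i, j)"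
      using U ij by (simp add: spec_eq[OF orth] mat_diag_mult_right[OF U] scalar_prod_def)
    finally show "(first_cols k U * (top_singular_mat k \<sigma> ^\<^sub>m 2) * (first_cols k U)\<^sup>T) $$ (i, j)
        = spec U (\<lambda>i. of_bool (i < k) * (\<sigma> (Suc i))\<^sup>2) $$ (i, j)"
      by (simp add: F_def sq)
  qed (use F spec_carrier[OF orth, of "\<lambda>i. of_bool (i < k) * (\<sigma> (Suc i))\<^sup>2"] in
      \<open>auto simp: F_def[symmetric]\<close>)
qed

section \<open>Perturbation of eigenvalues and eigenspaces\<close>

text \<open>Courant-Fischer argument: the span of the first \<open>i + 1\<close> columns of
  \<open>U\<close> contains a nonzero \<open>x\<close> orthogonal to the first \<open>i\<close>
  columns of \<open>V\<close>. On \<open>x\<close> the first quadratic form is at least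
  \<open>f i\<close> and the second at most \<open>g i\<close> times the squared length, while the
  two differ by at most \<open>e\<close> times it. The opposite inequality follows by exchanging the
  two matrices.\<close>

lemma weyl_le:
  assumes U: "orthonormal_square_mat n U" and V: "orthonormal_square_mat n V"
    and f: "\<And>i j. i \<le> j \<Longrightarrow> j < n \<Longrightarrow> f j \<le> f i"
    and g: "\<And>i j. i \<le> j \<Longrightarrow> j < n \<Longrightarrow> g j \<le> g i"
    and close: "op_norm (spec U f - spec V g) \<le> e"
    and i: "i < n"
  shows "f i \<le> g i + e"
proof -
  note cU = orth_carrier[OF U] and cV = orth_carrier[OF V]
  define W where "W = V\<^sup>T * U"
  have W: "W \<in> carrier_mat n n"
    using cU cV by (simp add: W_def)
  txt \<open>The kernel of this singular matrix consists of coordinates, with respect to \<open>U\<close>, of vectors in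
    the span of the first \<open>i + 1\<close> columns of \<open>U\<close> orthogonal to the first \<open>i\<close> columns of \<open>V\<close>.\<close>
  define M where "M = Matrix.mat n n (\<lambda>(j, m). if j < i then W $$ (j, m) else of_bool (i < j \<and> j = m))"
  have M: "M \<in> carrier_mat n n"
    by (simp add: M_def)
  \<comment> \<open>Row \<open>i\<close> of \<open>M\<close> is zero: \<open>i\<close> orthogonality
    conditions and \<open>n - i - 1\<close> vanishing coordinates make only \<open>n - 1\<close>
    equations. This replaces a dimension count.\<close>
  have "M\<^sup>T *\<^sub>v unit_vec n i = 0\<^sub>v n"
    using i by (intro eq_vecI) (auto simp: M_def)
  then have "det (M\<^sup>T) = 0"
    using det_0_iff_vec_prod_zero_field[of "M\<^sup>T" n] M i
    by (metis transpose_carrier_mat unit_vec_carrier unit_vec_nonzero)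
  then have "det M = 0"
    using det_transpose[OF M] by simp
  then obtain c where c: "c \<in> carrier_vec n" "c \<noteq> 0\<^sub>v n" and Mc: "M *\<^sub>v c = 0\<^sub>v n"
    using det_0_iff_vec_prod_zero_field[OF M] by blast
  define x where "x = U *\<^sub>v c"
  have x: "x \<in> carrier_vec n"
    using cU c by (simp add: x_def)
  define y where "y = V\<^sup>T *\<^sub>v x"
  have y: "y \<in> carrier_vec n"
    using cV x by (simp add: y_def)
  have norms: "vec_norm2 x = vec_norm2 c" "vec_norm2 y = vec_norm2 c"
    using c x by (simp_all add: x_def y_def orthonormal_vec_norm2[OF U] orthonormal_vec_norm2[OF V])
  have UTx: "U\<^sup>T *\<^sub>v x = c"
  proof -
    have "U\<^sup>T *\<^sub>v x = (U\<^sup>T * U) *\<^sub>v c"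
      unfolding x_def using cU c by (intro assoc_mult_mat_vec[symmetric, of _ n n _ n]) auto
    then show ?thesis
      using U c by (simp add: orthonormal_square_mat_def)
  qed
  have yW: "y = W *\<^sub>v c"
    unfolding y_def x_def W_def using cU cV c by (intro assoc_mult_mat_vec[symmetric, of _ n n _ n]) auto
  have y0: "y $ j = 0" if "j < i" for j
  proof -
    have "row M j = row W j"
      using that i W by (intro eq_vecI) (auto simp: M_def)
    then have "(W *\<^sub>v c) $ j = (M *\<^sub>v c) $ j"
      using that i W M by simp
    then show ?thesis
      using that i by (simp add: yW Mc)
  qed
  have c0: "c $ j = 0" if "i < j" "j < n" for j
  proof -
    have "row M j = unit_vec n j"
      using that by (intro eq_vecI) (auto simp: M_def)
    then have "(M *\<^sub>v c) $ j = c $ j"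
      using that M c by simp
    then show ?thesis
      using that by (simp add: Mc)
  qed
  have norm_sum: "(vec_norm2 z)\<^sup>2 = (\<Sum>j<n. (z $ j)\<^sup>2)" if "z \<in> carrier_vec n" for z
    unfolding vec_norm2_sq using that by (simp add: scalar_prod_def atLeast0LessThan power2_eq_square)
  \<comment> \<open>Only coordinates of \<open>c\<close> with \<open>j \<le> i\<close> can be
    nonzero, and there \<open>f j\<close> is at least \<open>f i\<close>.\<close>
  have "f i * (vec_norm2 c)\<^sup>2 \<le> (\<Sum>j<n. f j * (c $ j)\<^sup>2)"
    unfolding norm_sum[OF c(1)] sum_distrib_left
  proof (rule sum_mono)
    fix j assume "j \<in> {..<n}"
    then show "f i * (c $ j)\<^sup>2 \<le> f j * (c $ j)\<^sup>2"
      using c0[of j] f[of j i] i by (cases "j \<le> i") (auto intro: mult_right_mono)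
  qed
  also have "\<dots> = x \<bullet> (spec U f *\<^sub>v x)"
    by (simp add: spec_quadratic_form[OF U x] UTx)
  also have "\<dots> = x \<bullet> (spec V g *\<^sub>v x) + x \<bullet> ((spec U f - spec V g) *\<^sub>v x)"
  proof -
    have "spec U f *\<^sub>v x \<in> carrier_vec n" "spec V g *\<^sub>v x \<in> carrier_vec n"
      using mult_mat_vec_carrier[OF spec_carrier[OF U] x] mult_mat_vec_carrier[OF spec_carrier[OF V] x] by auto
    then show ?thesis
      using minus_mult_distrib_mat_vec[OF spec_carrier[OF U] spec_carrier[OF V] x] x
      by (simp add: scalar_prod_minus_distrib[of _ n])
  qed
  also have "x \<bullet> (spec V g *\<^sub>v x) = (\<Sum>j<n. g j * (y $ j)\<^sup>2)"
    by (simp add: spec_quadratic_form[OF V x] y_def)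
  \<comment> \<open>Dually, only coordinates of \<open>y\<close> with \<open>j \<ge> i\<close> can
    be nonzero, and there \<open>g j\<close> is at most \<open>g i\<close>.\<close>
  also have "\<dots> \<le> g i * (vec_norm2 y)\<^sup>2"
    unfolding norm_sum[OF y] sum_distrib_left
  proof (rule sum_mono)
    fix j assume "j \<in> {..<n}"
    then show "g j * (y $ j)\<^sup>2 \<le> g i * (y $ j)\<^sup>2"
      using y0[of j] g[of i j] by (cases "j < i") (auto intro: mult_right_mono)
  qed
  also have "x \<bullet> ((spec U f - spec V g) *\<^sub>v x) \<le> e * (vec_norm2 x)\<^sup>2"
  proof -
    have E: "spec U f - spec V g \<in> carrier_mat n n"
      using spec_carrier[OF V] by (rule minus_carrier_mat)
    have "x \<bullet> ((spec U f - spec V g) *\<^sub>v x) \<le> vec_norm2 x * vec_norm2 ((spec U f - spec V g) *\<^sub>v x)"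
      using abs_scalar_prod_le[of x "(spec U f - spec V g) *\<^sub>v x"] x mult_mat_vec_carrier[OF E x]
      by (metis abs_le_iff carrier_vecD)
    also have "\<dots> \<le> vec_norm2 x * (op_norm (spec U f - spec V g) * vec_norm2 x)"
      by (intro mult_left_mono vec_norm2_mult_le[OF E x]) simp
    also have "\<dots> \<le> vec_norm2 x * (e * vec_norm2 x)"
      using close by (intro mult_left_mono mult_right_mono) auto
    finally show ?thesis
      by (simp add: power2_eq_square ac_simps)
  qed
  finally have "f i * (vec_norm2 c)\<^sup>2 \<le> (g i + e) * (vec_norm2 c)\<^sup>2"
    by (simp add: norms distrib_right)
  moreover have "vec_norm2 c > 0"
    using vec_norm2_eq_0D[of c n] c by (auto simp: less_le)
  ultimately show ?thesis
    by simp
qed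

text \<open>Half-line case of the Davis-Kahan theorem: with \<open>E = spec U f - spec V g\<close>, \<open>p\<close>, \<open>q\<close> the two
  projections and \<open>r\<close> the inverse of \<open>spec U f\<close> on the range of \<open>p\<close>, the Sylvester identity
  \<open>q p = q E r + (q spec V g) (q p) r\<close> bounds the norm of \<open>q p\<close> in terms of itself.\<close>

lemma sin_theta:
  assumes U: "orthonormal_square_mat n U" and V: "orthonormal_square_mat n V"
    and close: "op_norm (spec U f - spec V g) \<le> e"
    and f: "\<And>i. i < n \<Longrightarrow> P i \<Longrightarrow> a \<le> f i"
    and g: "\<And>i. i < n \<Longrightarrow> Q i \<Longrightarrow> \<bar>g i\<bar> \<le> b"
    and "0 \<le> b" "b < a"
  shows "op_norm (spec V (\<lambda>i. of_bool (Q i)) * spec U (\<lambda>i. of_bool (P i))) * (a - b) \<le> e"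
proof -
  note carriers = spec_carrier[OF U] spec_carrier[OF V]
  note sq = mult_carrier_mat[of _ n n _ n] assoc_mult_mat[of _ n n _ n _ n] minus_carrier_mat
  define p where "p = spec U (\<lambda>i. of_bool (P i))"
  define q where "q = spec V (\<lambda>i. of_bool (Q i))"
  define r where "r = spec U (\<lambda>i. of_bool (P i) / f i)"
  define h where "h = spec V (\<lambda>i. of_bool (Q i) * g i)"
  define E where "E = spec U f - spec V g"
  have pqrh [simp]: "p \<in> carrier_mat n n" "q \<in> carrier_mat n n" "r \<in> carrier_mat n n"
    "h \<in> carrier_mat n n" "E \<in> carrier_mat n n"
    using carriers by (simp_all add: p_def q_def r_def h_def E_def minus_carrier_mat)
  \<comment> \<open>Where \<open>P\<close> holds, \<open>f\<close> is at least \<open>a > 0\<close>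
    and may be cancelled; elsewhere the numerator is 0, whatever the value of
    \<open>f\<close>.\<close>
  have Fr: "spec U f * r = p"
    unfolding r_def p_def spec_mult[OF U]
    using f \<open>0 \<le> b\<close> \<open>b < a\<close> by (intro spec_cong[OF U]) fastforce
  \<comment> \<open>This permits inserting a factor \<open>p\<close> before \<open>r\<close>, so
    that the product \<open>q * p\<close> reappears inside the Sylvester identity.\<close>
  have pr: "p * r = r"
    unfolding r_def p_def spec_mult[OF U] by (intro spec_cong[OF U]) auto
  have qG: "q * spec V g = h * q"
    unfolding q_def h_def spec_mult[OF V] by (intro spec_cong[OF V]) auto
  have "q * E * r = q * (spec U f * r) - (q * spec V g) * r"
    using carriers pqrh unfolding E_def
    by (simp add: sq mult_minus_distrib_mat[of _ n n _ n] minus_mult_distrib_mat[of _ n n _ _ n])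
  also have "\<dots> = q * p - h * q * (p * r)"
    by (simp only: Fr qG pr)
  also have "h * q * (p * r) = h * (q * p) * r"
    by (simp add: sq)
  finally have "q * E * r = q * p - h * (q * p) * r" .
  then have split: "q * p = q * E * r + h * (q * p) * r"
    by (simp only:) (rule mat_diff_add_cancel[symmetric, of _ n n], simp_all add: sq)
  have "op_norm (q * E * r + h * (q * p) * r) \<le> op_norm (q * E * r) + op_norm (h * (q * p) * r)"
    by (rule op_norm_add_le[of _ n n]) (simp_all add: sq)
  then have sum: "op_norm (q * p) \<le> op_norm (q * E * r) + op_norm (h * (q * p) * r)"
    by (simp only: split[symmetric])
  have q_le: "op_norm q \<le> 1"
    unfolding q_def by (rule op_norm_spec_le[OF V]) auto
  have r_le: "op_norm r \<le> 1 / a"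
    unfolding r_def using f \<open>0 \<le> b\<close> \<open>b < a\<close>
    by (intro op_norm_spec_le[OF U]) (fastforce simp: field_simps)+
  have h_le: "op_norm h \<le> b"
    unfolding h_def using g \<open>0 \<le> b\<close> by (intro op_norm_spec_le[OF V]) auto
  have "op_norm (q * E * r) \<le> 1 * e * (1 / a)"
    by (rule op_norm_mult3_le[of _ n]) (use close q_le r_le in \<open>auto simp: E_def[symmetric]\<close>)
  moreover have "op_norm (h * (q * p) * r) \<le> b * op_norm (q * p) * (1 / a)"
    by (rule op_norm_mult3_le[of _ n]) (use h_le r_le in \<open>auto simp: sq\<close>)
  ultimately have "op_norm (q * p) \<le> 1 * e * (1 / a) + b * op_norm (q * p) * (1 / a)"
    using sum by linarith
  \<comment> \<open>Multiplying by \<open>a\<close> and moving the term with \<open>b\<close> to the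
    left solves the self-referential inequality.\<close>
  then have "op_norm (q * p) * (a - b) \<le> e"
    using \<open>0 \<le> b\<close> \<open>b < a\<close> by (simp add: field_simps)
  then show ?thesis
    by (simp add: p_def q_def)
qed


text \<open>Each product on the right contains a complementary projection \<open>1 - p'\<close> or
  \<open>1 - p\<close>; on expanding, the cross terms \<open>p * p'\<close> cancel. Both products
  pair eigenspaces on opposite sides of the gap, as \<open>sin_theta\<close> requires.\<close>

lemma spec_projection_diff:
  assumes U: "orthonormal_square_mat n U" and V: "orthonormal_square_mat n V"
  shows "spec U (\<lambda>i. of_bool (i < k)) - spec V (\<lambda>i. of_bool (i < k))
    = spec U (\<lambda>i. of_bool (i < k)) * spec V (\<lambda>i. of_bool (k \<le> i))
      - spec U (\<lambda>i. of_bool (k \<le> i)) * spec V (\<lambda>i. of_bool (i < k))"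
proof -
  note carriers = spec_carrier[OF U] spec_carrier[OF V]
  define p where "p = spec U (\<lambda>i. of_bool (i < k))"
  define p' where "p' = spec V (\<lambda>i. of_bool (i < k))"
  have [simp]: "p \<in> carrier_mat n n" "p' \<in> carrier_mat n n" "p * p' \<in> carrier_mat n n"
    using carriers by (simp_all add: p_def p'_def mult_carrier_mat[of _ n n _ n])
  have compl: "spec W (\<lambda>i. of_bool (k \<le> i)) = 1\<^sub>m n - spec W (\<lambda>i. of_bool (i < k))"
    if "orthonormal_square_mat n W" for W
    unfolding spec_one[OF that, symmetric] spec_diff[OF that]
    by (intro arg_cong[of _ _ "spec W"]) auto
  have "p * (1\<^sub>m n - p') = p - p * p'"
    by (simp add: mult_minus_distrib_mat[of _ n n _ n] right_mult_one_mat[of _ n n])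
  moreover have "(1\<^sub>m n - p) * p' = p' - p * p'"
    by (simp add: minus_mult_distrib_mat[of _ n n _ _ n] left_mult_one_mat[of _ n n])
  moreover have "p - p' = (p - p * p') - (p' - p * p')"
    using carrier_matD[of p n n] carrier_matD[of p' n n] carrier_matD[of "p * p'" n n]
    by (intro eq_matI) (auto simp del: index_mult_mat)
  ultimately show ?thesis
    by (simp only: compl[OF U] compl[OF V] p_def[symmetric] p'_def[symmetric])
qed

lemma truncation_perturbation:
  assumes U: "orthonormal_square_mat n U" and V: "orthonormal_square_mat n V"
    and f: "\<And>i j. i \<le> j \<Longrightarrow> j < n \<Longrightarrow> f j \<le> f i"
    and g: "\<And>i j. i \<le> j \<Longrightarrow> j < n \<Longrightarrow> g j \<le> g i"
    and nonneg: "\<And>i. 0 \<le> f i" "\<And>i. 0 \<le> g i"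
    and close: "op_norm (spec U f - spec V g) \<le> e"
    and k: "0 < k" "k < n"
    and gap: "f k + \<delta> \<le> f (k - 1)" and "e < \<delta>"
  shows "op_norm (spec U (\<lambda>i. of_bool (i < k) * f i) - spec V (\<lambda>i. of_bool (i < k) * f i))
    \<le> 2 * e / (\<delta> - e) * f 0 + 2 * e"
proof -
  note carriers = spec_carrier[OF U] spec_carrier[OF V]
  have e: "0 \<le> e"
    using close op_norm_nonneg order.trans by blast
  have close': "op_norm (spec V g - spec U f) \<le> e"
    using op_norm_minus_commute_le[OF spec_carrier[OF V] spec_carrier[OF U]] close order.trans by blast
  have fg: "f i \<le> g i + e" and gf: "g i \<le> f i + e" if "i < n" for i
    using weyl_le[OF U V f g close that] weyl_le[OF V U g f close' that] by auto
  define p where "p = spec U (\<lambda>i. of_bool (i < k))"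
  define p' where "p' = spec V (\<lambda>i. of_bool (i < k))"
  define q where "q = spec U (\<lambda>i. of_bool (k \<le> i))"
  define q' where "q' = spec V (\<lambda>i. of_bool (k \<le> i))"
  define F where "F = spec U f"
  define G where "G = spec V g"
  have c [simp]: "p \<in> carrier_mat n n" "p' \<in> carrier_mat n n" "q \<in> carrier_mat n n"
    "q' \<in> carrier_mat n n" "F \<in> carrier_mat n n" "G \<in> carrier_mat n n"
    using carriers by (simp_all add: p_def p'_def q_def q'_def F_def G_def)
  have c2 [simp]: "A * B \<in> carrier_mat n n" "A - B \<in> carrier_mat n n"
    if "A \<in> carrier_mat n n" "B \<in> carrier_mat n n" for A B :: "real mat"
    using that by (auto intro: minus_carrier_mat)
  have k': "k - 1 < n"
    using k by simp
  \<comment> \<open>By Weyl, \<open>g k\<close> is at most \<open>f k + e\<close>, so the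
    perturbation shrinks the gap from \<open>\<delta>\<close> to no less than
    \<open>\<delta> - e\<close>.\<close>
  have "op_norm (q' * p) * (f (k - 1) - g k) \<le> e"
    unfolding q'_def p_def
    by (rule sin_theta[OF U V close]) (use f g nonneg k gap gf[of k] \<open>e < \<delta>\<close> in auto)
  moreover have "op_norm (q' * p) * (\<delta> - e) \<le> op_norm (q' * p) * (f (k - 1) - g k)"
    using gf[of k] k gap by (intro mult_left_mono) auto
  ultimately have q'p: "op_norm (q' * p) \<le> e / (\<delta> - e)"
    using \<open>e < \<delta>\<close> by (simp add: field_simps)
  \<comment> \<open>The same with the matrices exchanged: now the upper eigenvalues belong to
    \<open>G\<close>, and Weyl gives \<open>g (k - 1) \<ge> f (k - 1) - e\<close>.\<close>
  have "op_norm (q * p') * (g (k - 1) - f k) \<le> e"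
    unfolding q_def p'_def
    by (rule sin_theta[OF V U close']) (use f g nonneg k gap fg[OF k'] \<open>e < \<delta>\<close> in auto)
  moreover have "op_norm (q * p') * (\<delta> - e) \<le> op_norm (q * p') * (g (k - 1) - f k)"
    using fg[OF k'] gap by (intro mult_left_mono) auto
  ultimately have qp': "op_norm (q * p') \<le> e / (\<delta> - e)"
    using \<open>e < \<delta>\<close> by (simp add: field_simps)
  \<comment> \<open>The decomposition of \<open>p - p'\<close> needs the factors in the other order;
    all projections are symmetric, so transposition supplies it.\<close>
  have "(q' * p)\<^sup>T = p * q'"
    by (simp add: transpose_mult[of _ n n _ n] p_def q'_def transpose_spec[OF U] transpose_spec[OF V] carriers)
  then have pq': "op_norm (p * q') \<le> e / (\<delta> - e)"
    using op_norm_transpose_le[of "q' * p" n n] q'p by simp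
  have "op_norm (p - p') \<le> op_norm (p * q') + op_norm (q * p')"
    using op_norm_diff_le[of "p * q'" n n "q * p'"]
    by (simp add: spec_projection_diff[OF U V] p_def p'_def q_def q'_def carriers)
  then have pp': "op_norm (p - p') \<le> 2 * e / (\<delta> - e)"
    using pq' qp' by (simp add: add_divide_distrib[symmetric])
  have F_le: "op_norm F \<le> f 0"
    unfolding F_def using f nonneg by (intro op_norm_spec_le[OF U]) auto
  have p'_le: "op_norm p' \<le> 1"
    unfolding p'_def by (intro op_norm_spec_le[OF V]) auto
  \<comment> \<open>\<open>R\<close> corrects for keeping the eigenvalues \<open>f\<close> with the
    eigenvectors of \<open>G\<close>; Weyl bounds its entries by \<open>e\<close>.\<close>
  define R where "R = spec V (\<lambda>i. of_bool (i < k) * (g i - f i))"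
  have R: "R \<in> carrier_mat n n"
    by (simp add: R_def carriers)
  have R_le: "op_norm R \<le> e"
    unfolding R_def using fg gf e by (intro op_norm_spec_le[OF V]) (auto simp: abs_le_iff algebra_simps)
  define T' where "T' = spec V (\<lambda>i. of_bool (i < k) * f i)"
  have T': "T' \<in> carrier_mat n n"
    by (simp add: T'_def carriers)
  have "spec U (\<lambda>i. of_bool (i < k) * f i) = p * F"
    by (simp add: p_def F_def spec_mult[OF U])
  moreover have "R = p' * G - T'"
    by (simp add: R_def p'_def G_def T'_def spec_mult[OF V] spec_diff[OF V] algebra_simps)
  \<comment> \<open>Telescoping through \<open>p' * F\<close> and \<open>p' * G\<close> separates
    the changes of projection, of matrix and of eigenvalues.\<close>
  moreover have "p * F - T' = (p * F - p' * F) + (p' * F - p' * G) + (p' * G - T')"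
    using T' c2(1)[of p F] c2(1)[of p' F] c2(1)[of p' G]
    by (intro eq_matI) (auto simp del: index_mult_mat c2)
  ultimately have "spec U (\<lambda>i. of_bool (i < k) * f i) - T' = (p - p') * F + p' * (F - G) + R"
    by (simp add: minus_mult_distrib_mat[of _ n n _ _ n] mult_minus_distrib_mat[of _ n n _ n])
  moreover have "op_norm ((p - p') * F + p' * (F - G) + R)
      \<le> op_norm ((p - p') * F) + op_norm (p' * (F - G)) + op_norm R"
    by (rule order.trans[OF op_norm_add_le[of _ n n]])
      (use R in \<open>auto intro!: op_norm_add_le[of _ n n]\<close>)
  moreover have "op_norm ((p - p') * F) \<le> 2 * e / (\<delta> - e) * f 0"
    by (rule order.trans[OF op_norm_mult_le[of _ n n _ n] mult_mono])
      (use pp' F_le e \<open>e < \<delta>\<close> in auto)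
  moreover have "op_norm (p' * (F - G)) \<le> 1 * e"
    by (rule order.trans[OF op_norm_mult_le[of _ n n _ n] mult_mono])
      (use p'_le close in \<open>auto simp: F_def G_def carriers intro: minus_carrier_mat\<close>)
  ultimately show ?thesis
    using R_le by (simp add: T'_def)
qed

section \<open>The numerical estimate\<close>

text \<open>Here \<open>s\<close> stands for the squared largest singular value and \<open>K\<close>
  for \<open>k\<close>. With \<open>t\<close> the cube root of \<open>\<mu> * K\<close>, one bound
  on \<open>\<mu>\<close> makes \<open>t\<close> small and the other makes
  \<open>\<mu> / \<Delta>\<close> at most the square of \<open>t\<close>.\<close>

lemma perturbation_rate:
  fixes \<Delta> \<mu> K s :: real
  assumes "0 < s" "0 < \<Delta>" "\<Delta> \<le> 1" "0 \<le> \<mu>" "1 \<le> K"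
    and mu: "\<mu> \<le> \<Delta> ^ 3 * K\<^sup>2" "\<mu> \<le> 1 / (20 * K)"
  shows "\<mu> * s < \<Delta> * s"
    and "2 * (\<mu> * s) / (\<Delta> * s - \<mu> * s) * s + 2 * (\<mu> * s) \<le> 8 * s * (\<mu> * K) powr (1 / 3)"
proof -
  define t where "t = (\<mu> * K) powr (1 / 3)"
  have muK: "0 \<le> \<mu> * K"
    using assms by simp
  have t: "0 \<le> t"
    by (simp add: t_def)
  have t3: "t ^ 3 = \<mu> * K"
  proof (cases "\<mu> * K = 0")
    case False
    then have "t ^ 3 = (\<mu> * K) powr 1"
      unfolding t_def by (subst powr_power) auto
    then show ?thesis
      using muK by simp
  qed (simp only: t_def, simp)
  have "\<mu> * K \<le> 1 / 20"
    using mu(2) \<open>1 \<le> K\<close> by (simp add: field_simps)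
  \<comment> \<open>The value 2/5 is a convenient rational upper bound for the cube root of 1/20,
    since its cube is 8/125.\<close>
  also have "1 / 20 \<le> (2 / 5 :: real) ^ 3"
    by (simp add: power_divide)
  finally have "t ^ 3 \<le> (2 / 5) ^ 3"
    by (simp only: t3)
  then have t_le: "t \<le> 2 / 5"
    using power_mono_iff[of t "2 / 5" 3] t by simp
  \<comment> \<open>Multiplying the hypothesis by the square of \<open>\<mu>\<close> turns
    \<open>K\<^sup>2\<close> into \<open>(\<mu> * K)\<^sup>2\<close>, the sixth power of
    \<open>t\<close>, so that a cube root can be taken.\<close>
  have "\<mu> ^ 3 \<le> \<Delta> ^ 3 * K\<^sup>2 * \<mu>\<^sup>2"
    using mult_right_mono[OF mu(1), of "\<mu>\<^sup>2"] by (simp add: power2_eq_square power3_eq_cube)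
  also have "\<dots> = (\<Delta> * t\<^sup>2) ^ 3"
  proof -
    have "(t\<^sup>2) ^ 3 = (t ^ 3)\<^sup>2"
      by (simp flip: power_mult)
    then show ?thesis
      by (simp only: t3 power_mult_distrib mult.assoc mult.commute[of "K\<^sup>2"])
  qed
  finally have mu_le: "\<mu> \<le> \<Delta> * t\<^sup>2"
    using power_mono_iff[of \<mu> "\<Delta> * t\<^sup>2" 3] \<open>0 < \<Delta>\<close> \<open>0 \<le> \<mu>\<close> by simp
  have t2: "t\<^sup>2 \<le> 2 / 5 * t"
    using mult_right_mono[OF t_le t] by (simp add: power2_eq_square)
  have "t\<^sup>2 \<le> 4 / 25"
    using t2 t_le by linarith
  then have "\<Delta> * t\<^sup>2 \<le> \<Delta> * (4 / 25)"
    using \<open>0 < \<Delta>\<close> by (intro mult_left_mono) auto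
  then have d: "21 / 25 * \<Delta> \<le> \<Delta> - \<mu>"
    using mu_le by linarith
  then have pos: "0 < \<Delta> - \<mu>"
    using \<open>0 < \<Delta>\<close> by linarith
  then show "\<mu> * s < \<Delta> * s"
    using \<open>0 < s\<close> by simp
  \<comment> \<open>The factor 21/25 is 1 - 4/25, and 5/2 times 21/25 is 21/10, which exceeds the
    required 2.\<close>
  have "2 * \<mu> \<le> 5 / 2 * t\<^sup>2 * (\<Delta> - \<mu>)"
    using mult_left_mono[OF d, of "5 / 2 * t\<^sup>2"] mu_le \<open>0 \<le> \<mu>\<close> by (simp add: algebra_simps)
  then have "2 * \<mu> / (\<Delta> - \<mu>) \<le> 5 / 2 * t\<^sup>2"
    using pos by (simp add: divide_le_eq)
  moreover have "\<mu> \<le> t\<^sup>2"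
    using mu_le \<open>\<Delta> \<le> 1\<close> mult_right_mono[of \<Delta> 1 "t\<^sup>2"] by simp
  \<comment> \<open>The left side is at most 9/2 times the square of \<open>t\<close>, hence at most
    9/5 times \<open>t\<close>.\<close>
  ultimately have "2 * \<mu> / (\<Delta> - \<mu>) + 2 * \<mu> \<le> 8 * t"
    using t2 t by linarith
  then have "s * (2 * \<mu> / (\<Delta> - \<mu>) + 2 * \<mu>) \<le> s * (8 * t)"
    using \<open>0 < s\<close> by (intro mult_left_mono) auto
  moreover have "2 * (\<mu> * s) / (\<Delta> * s - \<mu> * s) = 2 * \<mu> / (\<Delta> - \<mu>)"
    using \<open>0 < s\<close> pos by (simp add: field_simps)
  ultimately show "2 * (\<mu> * s) / (\<Delta> * s - \<mu> * s) * s + 2 * (\<mu> * s) \<le> 8 * s * (\<mu> * K) powr (1 / 3)"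
    unfolding t_def[symmetric] by (simp add: algebra_simps)
qed

theorem theorem4:
  fixes A U V A' U' V' :: "real mat"
    and \<sigma> \<sigma>' :: "nat \<Rightarrow> real"
    and n d l k :: nat
    and \<Delta> \<mu> :: real
  assumes svd_A: "is_svd n d A U \<sigma> V"
    and pos: "\<sigma> d > 0"
    and k: "1 \<le> k" "k < d"
    and Delta: "\<Delta> > 0"
    and gap: "(\<sigma> k)^2 - (\<sigma> (k + 1))^2 \<ge> \<Delta> * (\<sigma> 1)^2"
    and svd_A': "is_svd n l A' U' \<sigma>' V'"
    and approx: "op_norm (A * A\<^sup>T - A' * A'\<^sup>T) \<le> \<mu> * (\<sigma> 1)^2"
    and mu: "\<mu> \<le> min (\<Delta>^3 * (real k)^2) (1 / (20 * real k))"
  shows "op_norm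
      (first_cols k U * (top_singular_mat k \<sigma> ^\<^sub>m 2) * (first_cols k U)\<^sup>T
       - first_cols k U' * (top_singular_mat k \<sigma> ^\<^sub>m 2) * (first_cols k U')\<^sup>T)
    \<le> 8 * (\<sigma> 1)^2 * (\<mu> * real k) powr (1 / 3)"
proof -
  \<comment> \<open>The index shift matters: \<open>f i\<close> belongs to singular value number
    \<open>i + 1\<close>, so the gap lies between \<open>f (k - 1)\<close> and
    \<open>f k\<close>.\<close>
  define f where "f = (\<lambda>i. (\<sigma> (Suc i))\<^sup>2)"
  define g where "g = (\<lambda>i. (\<sigma>' (Suc i))\<^sup>2)"
  have U: "orthonormal_square_mat n U" and U': "orthonormal_square_mat n U'"
    and nonneg: "\<And>i. 1 \<le> i \<Longrightarrow> 0 \<le> \<sigma> i" "\<And>i. 1 \<le> i \<Longrightarrow> 0 \<le> \<sigma>' i"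
    and mono: "\<And>i j. 1 \<le> i \<Longrightarrow> i \<le> j \<Longrightarrow> \<sigma> j \<le> \<sigma> i" "\<And>i j. 1 \<le> i \<Longrightarrow> i \<le> j \<Longrightarrow> \<sigma>' j \<le> \<sigma>' i"
    and zero: "\<And>i. i > min n d \<Longrightarrow> \<sigma> i = 0"
    using svd_A svd_A' by (auto simp: is_svd_def)
  have "d \<le> n"
    using pos zero[of d] by (cases "d \<le> n") auto
  then have kn: "k < n"
    using k by simp
  have f: "f j \<le> f i" and g: "g j \<le> g i" if "i \<le> j" for i j
    using that nonneg mono by (auto simp: f_def g_def intro!: power_mono)
  have "\<sigma> 1 > 0"
    using pos mono(1)[of 1 d] k by simp
  then have s: "(\<sigma> 1)\<^sup>2 > 0"
    by simp
  \<comment> \<open>The gap cannot exceed the largest eigenvalue, which forces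
    \<open>\<Delta> \<le> 1\<close>.\<close>
  have "\<Delta> * (\<sigma> 1)\<^sup>2 \<le> 1 * (\<sigma> 1)\<^sup>2"
  proof -
    have "(\<sigma> k)\<^sup>2 \<le> (\<sigma> 1)\<^sup>2"
      using f[of 0 "k - 1"] k by (simp add: f_def)
    then show ?thesis
      using gap zero_le_power2[of "\<sigma> (k + 1)"] by linarith
  qed
  then have "\<Delta> \<le> 1"
    using s by (simp only: mult_le_cancel_right_pos)
  \<comment> \<open>Nonnegativity of \<open>\<mu>\<close> is implicit in its being a bound for a
    norm.\<close>
  have "0 \<le> \<mu> * (\<sigma> 1)\<^sup>2"
    using approx op_norm_nonneg order.trans by blast
  then have "0 \<le> \<mu>"
    using s by (simp add: zero_le_mult_iff)
  note rate = perturbation_rate[OF s Delta \<open>\<Delta> \<le> 1\<close> \<open>0 \<le> \<mu>\<close>, of "real k"]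
  have "op_norm (spec U (\<lambda>i. of_bool (i < k) * f i) - spec U' (\<lambda>i. of_bool (i < k) * f i))
      \<le> 2 * (\<mu> * (\<sigma> 1)\<^sup>2) / (\<Delta> * (\<sigma> 1)\<^sup>2 - \<mu> * (\<sigma> 1)\<^sup>2) * f 0 + 2 * (\<mu> * (\<sigma> 1)\<^sup>2)"
  proof (rule truncation_perturbation[OF U U'])
    show "op_norm (spec U f - spec U' g) \<le> \<mu> * (\<sigma> 1)\<^sup>2"
      using approx by (simp add: svd_gram[OF svd_A] svd_gram[OF svd_A'] f_def g_def)
    show "f k + \<Delta> * (\<sigma> 1)\<^sup>2 \<le> f (k - 1)"
      using gap k by (simp add: f_def)
    show "\<mu> * (\<sigma> 1)\<^sup>2 < \<Delta> * (\<sigma> 1)\<^sup>2"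
      using rate(1) mu k by simp
  qed (use f g k kn in \<open>auto simp: f_def g_def\<close>)
  also have "\<dots> \<le> 8 * (\<sigma> 1)\<^sup>2 * (\<mu> * real k) powr (1 / 3)"
    using rate(2) mu k by (simp add: f_def)
  finally show ?thesis
    using kn by (simp add: truncated_eq_spec[OF U] truncated_eq_spec[OF U'] f_def)
qed

end
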